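(* Let $G$ be an undirected graph with $N$ vertices and $\ell_G$ edges. The mean of the mp-chart $H_G$ of $G$ is $$\mathbb{E}(H_G)=\frac{2\ell_G}{N}.$$
   Context: Graphs are finite, undirected and without loops (and without multiple edges), with $N\ge 1$ vertices labelled $1,\dots,N$. The adjacency matrix $A_G$ of $G=(V,E)$ is the symmetric $N\times N$ matrix with $(A_G)_{i,j}=1$ if $(i,j)\in E$ and $0$ otherwise; its diagonal entries are zero. The number of edges $\ell_G$ counts unordered pairs $\{i,j\}$ joined by an edge. For $0\le k\le N$, $h_G(k)$ is the number of permutations $\pi$ of $\{1,\dots,N\}$ such that $\sum_{i=1}^N (A_G)_{i,\pi(i)}=k$. The mp-chart of $G$ is the vector $H_G=(h_G(0),\dots,h_G(N))$. Its mean is $$\mathbb{E}(H_G)=\frac{\sum_{k=0}^N k\,h_G(k)}{N!}.$$ *)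

theory Defs
  imports
    Complex_Main
    "HOL-Combinatorics.Permutations"
    "Graph_Theory.Pair_Digraph"
begin

text \<open>
  A finite simple undirected graph is a \<open>pair_graph\<close>: a finite loop-free digraph whose arcs are
  pairs of vertices and form a symmetric relation. An undirected edge \<open>{i, j}\<close> is thus represented
  by the two arcs \<open>(i, j)\<close> and \<open>(j, i)\<close>; \<open>num_edges\<close> counts it once.
\<close>

definition num_edges :: "'a pair_pre_digraph \<Rightarrow> nat" where
  "num_edges G = card {{i, j} | i j. (i, j) \<in> parcs G}"

definition adj :: "'a pair_pre_digraph \<Rightarrow> 'a \<Rightarrow> 'a \<Rightarrow> nat" where
  "adj G i j = (if (i, j) \<in> parcs G then 1 else 0)"

definition mp_count :: "'a pair_pre_digraph \<Rightarrow> nat \<Rightarrow> nat" where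
  "mp_count G k = card {p. p permutes pverts G \<and> (\<Sum>i\<in>pverts G. adj G i (p i)) = k}"

definition mp_chart :: "'a pair_pre_digraph \<Rightarrow> nat list" where
  "mp_chart G = map (mp_count G) [0..<card (pverts G) + 1]"

text \<open>A chart \<open>(h(0), \<dots>, h(N))\<close> has \<open>N + 1\<close> entries.\<close>

definition chart_mean :: "nat list \<Rightarrow> real" where
  "chart_mean H = (let N = length H - 1 in (\<Sum>k=0..N. real k * real (H ! k)) / fact N)"

end

theory Submission
  imports Defs
begin

text \<open>
  Dividing by \<open>N!\<close> turns the chart into the distribution of
  \<open>\<Sum>i. adj G i (p i)\<close> for a uniformly random permutation \<open>p\<close>, so its first moment can be
  computed by linearity of expectation. Summing \<open>k\<close> times the number of permutations
  with total \<open>k\<close> gives the sum of the totals over all permutations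
  (\<open>sum_values_weighted_by_fibre_card\<close>); exchanging the two sums reduces the matter to the number
  of permutations that send a given \<open>i\<close> to a given \<open>j\<close>. That number is \<open>(N - 1)!\<close> whatever \<open>i\<close> and
  \<open>j\<close> are (\<open>card_permutes_prescribed_value\<close>), so every arc contributes exactly \<open>(N - 1)!\<close> to the
  first moment. There are \<open>2 \<ell>\<close> arcs (\<open>card_parcs_eq_twice_num_edges\<close>), and
  \<open>2 \<ell> (N - 1)! / N! = 2 \<ell> / N\<close>.
\<close>

lemma sum_values_weighted_by_fibre_card:
  fixes f :: "'a \<Rightarrow> nat"
  assumes "finite P" and "\<And>p. p \<in> P \<Longrightarrow> f p \<le> n"
  shows "(\<Sum>k=0..n. k * card {p \<in> P. f p = k}) = (\<Sum>p\<in>P. f p)"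
proof -
  have "k * card {p \<in> P. f p = k} = (\<Sum>p\<in>{p \<in> P. f p = k}. f p)" for k
    by simp
  then show ?thesis
    using sum.group[of P "{0..n}" f f] assms by (simp add: image_subset_iff mult.commute)
qed

text \<open>
  Composing with the transposition of \<open>i\<close> and \<open>j\<close> turns the condition \<open>p i = j\<close> into \<open>p i = i\<close>, and
  the permutations fixing \<open>i\<close> are the permutations of the remaining elements.
\<close>

lemma card_permutes_prescribed_value:
  assumes "finite S" and i: "i \<in> S" and j: "j \<in> S"
  shows "card {p. p permutes S \<and> p i = j} = fact (card S - 1)"
proof -
  let ?t = "transpose i j"
  have t: "?t permutes S"
    using i j by (rule permutes_swap_id)
  have "bij_betw (\<lambda>q. ?t \<circ> q) {q. q permutes (S - {i})} {p. p permutes S \<and> p i = j}"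
  proof (rule bij_betw_byWitness[where f' = "\<lambda>p. ?t \<circ> p"])
    show "(\<lambda>q. ?t \<circ> q) ` {q. q permutes (S - {i})} \<subseteq> {p. p permutes S \<and> p i = j}"
    proof (safe; simp)
      fix q assume q: "q permutes (S - {i})"
      then have "q permutes S"
        by (rule permutes_subset) auto
      with t show "?t \<circ> q permutes S"
        by (blast intro: permutes_compose)
      show "?t (q i) = j"
        using permutes_not_in[OF q, of i] by simp
    qed
    show "(\<lambda>p. ?t \<circ> p) ` {p. p permutes S \<and> p i = j} \<subseteq> {q. q permutes (S - {i})}"
    proof safe
      fix p assume p: "p permutes S" and "j = p i"
      then have "?t \<circ> p permutes S"
        using t by (blast intro: permutes_compose)
      moreover have "(?t \<circ> p) x = x" if "x \<in> S - (S - {i})" for x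
        using that \<open>j = p i\<close> by auto
      ultimately show "transpose i (p i) \<circ> p permutes (S - {i})"
        using \<open>j = p i\<close> by (auto intro: permutes_superset)
    qed
  qed (auto simp: fun_eq_iff)
  then have "card {p. p permutes S \<and> p i = j} = card {q. q permutes (S - {i})}"
    by (simp add: bij_betw_same_card)
  also have "\<dots> = fact (card S - 1)"
    using assms by (intro card_permutations) auto
  finally show ?thesis .
qed

text \<open>
  As the graph is undirected and loop-free, \<open>(i, j)\<close> and \<open>(j, i)\<close> are two distinct arcs, and the only
  ones, over the edge \<open>{i, j}\<close>: the map from arcs to edges is two-to-one.
\<close>

lemma card_parcs_eq_twice_num_edges:
  assumes "pair_graph G"
  shows "card (parcs G) = 2 * num_edges G"
proof -
  interpret pair_graph G by fact
  let ?edge = "\<lambda>(i, j). {i, j}"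
  have fibre: "card {a \<in> parcs G. ?edge a = e} = 2" if "e \<in> ?edge ` parcs G" for e
  proof -
    from that obtain i j where ij: "(i, j) \<in> parcs G" and e: "e = {i, j}"
      by auto
    have "(j, i) \<in> parcs G"
      using ij arcs_symmetric by blast
    with ij have "{a \<in> parcs G. ?edge a = e} = {(i, j), (j, i)}"
      unfolding e by (fastforce simp only: doubleton_eq_iff split: prod.splits)
    moreover have "i \<noteq> j"
      using ij by (rule no_loops')
    ultimately show ?thesis
      by simp
  qed
  have "card (parcs G) = (\<Sum>e\<in>?edge ` parcs G. card {a \<in> parcs G. ?edge a = e})"
    using sum.image_gen[of "parcs G" "\<lambda>_. 1::nat" ?edge] by simp
  also have "\<dots> = 2 * card (?edge ` parcs G)"
    using fibre by simp
  also have "?edge ` parcs G = {{i, j} | i j. (i, j) \<in> parcs G}"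
    by auto
  finally show ?thesis
    by (simp add: num_edges_def)
qed

lemma sum_adj_eq_card_parcs:
  assumes "pair_fin_digraph G"
  shows "(\<Sum>i\<in>pverts G. \<Sum>j\<in>pverts G. adj G i j) = card (parcs G)"
proof -
  interpret pair_fin_digraph G by fact
  have sub: "parcs G \<subseteq> pverts G \<times> pverts G"
    using in_arcsD1 in_arcsD2 by auto
  have "(\<Sum>i\<in>pverts G. \<Sum>j\<in>pverts G. adj G i j)
      = (\<Sum>a\<in>pverts G \<times> pverts G. if a \<in> parcs G then 1 else 0)"
    by (simp add: adj_def sum.cartesian_product case_prod_unfold)
  also have "\<dots> = card (parcs G)"
    using sub by (simp add: sum.If_cases Int_absorb1)
  finally show ?thesis .
qed

text \<open>
  The inner total depends on \<open>p\<close> only through the values \<open>p i\<close>, each of which is equidistributed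
  over \<open>S\<close>; hence any weight function \<open>w\<close> can take the place of the adjacency matrix.
\<close>

lemma sum_permutations_of_diagonal_sum:
  fixes w :: "'a \<Rightarrow> 'a \<Rightarrow> nat"
  assumes fin: "finite S"
  shows "(\<Sum>p | p permutes S. \<Sum>i\<in>S. w i (p i)) = fact (card S - 1) * (\<Sum>i\<in>S. \<Sum>j\<in>S. w i j)"
proof -
  let ?P = "{p. p permutes S}"
  have "(\<Sum>p\<in>?P. w i (p i)) = (\<Sum>j\<in>S. fact (card S - 1) * w i j)" if i: "i \<in> S" for i
  proof -
    have "(\<Sum>p\<in>?P. w i (p i)) = (\<Sum>j\<in>S. \<Sum>p\<in>{p \<in> ?P. p i = j}. w i (p i))"
      by (rule sum.group[symmetric])
        (use i fin in \<open>auto simp: finite_permutations permutes_in_image\<close>)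
    also have "\<dots> = (\<Sum>j\<in>S. card {p. p permutes S \<and> p i = j} * w i j)"
      by simp
    also have "\<dots> = (\<Sum>j\<in>S. fact (card S - 1) * w i j)"
      using card_permutes_prescribed_value[OF fin i] by simp
    finally show ?thesis .
  qed
  then have "(\<Sum>i\<in>S. \<Sum>p\<in>?P. w i (p i)) = fact (card S - 1) * (\<Sum>i\<in>S. \<Sum>j\<in>S. w i j)"
    by (simp add: sum_distrib_left)
  then show ?thesis
    by (subst sum.swap)
qed

theorem theorem3p3:
  fixes G :: "nat pair_pre_digraph" and N :: nat
  assumes "N \<ge> 1"
    and "pair_graph G"
    and "pverts G = {1..N}"
  shows "chart_mean (mp_chart G) = 2 * real (num_edges G) / real N"
proof -
  interpret pair_graph G by fact
  let ?V = "pverts G"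
  let ?P = "{p. p permutes ?V}"
  let ?total = "\<lambda>p. \<Sum>i\<in>?V. adj G i (p i)"
  have card: "card ?V = N"
    using assms(3) by simp
  have "?total p \<le> N" for p
    using sum_bounded_above[of ?V "\<lambda>i. adj G i (p i)" 1] by (simp add: adj_def card)
  then have "(\<Sum>k=0..N. k * mp_count G k) = (\<Sum>p\<in>?P. ?total p)"
    using sum_values_weighted_by_fibre_card[of ?P ?total N]
    by (simp add: mp_count_def finite_permutations)
  also have "\<dots> = fact (N - 1) * card (parcs G)"
    by (simp add: sum_permutations_of_diagonal_sum card
        sum_adj_eq_card_parcs[OF pair_fin_digraph_axioms])
  also have "\<dots> = fact (N - 1) * (2 * num_edges G)"
    using card_parcs_eq_twice_num_edges[OF assms(2)] by simp
  finally have moment: "(\<Sum>k=0..N. k * mp_count G k) = fact (N - 1) * (2 * num_edges G)" .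

  have entry: "mp_chart G ! k = mp_count G k" if "k \<le> N" for k
    unfolding mp_chart_def card using that by (simp del: upt_Suc)
  have "chart_mean (mp_chart G) = (\<Sum>k=0..N. real k * real (mp_chart G ! k)) / fact N"
    by (simp add: chart_mean_def mp_chart_def card)
  also have "\<dots> = real (\<Sum>k=0..N. k * mp_count G k) / fact N"
    by (simp add: entry)
  also have "\<dots> = fact (N - 1) * (2 * real (num_edges G)) / (real N * fact (N - 1))"
    using assms(1) by (simp add: moment fact_reduce[of N])
  also have "\<dots> = 2 * real (num_edges G) / real N"
    by simp
  finally show ?thesis .
qed

end
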